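(* Let $\sigma(n)$ be a nondecreasing unbounded computable function. Then there exist a computable ergodic transformation $T$ of $\Omega$ preserving the uniform Bernoulli measure $B_{1/2}$ and an infinite sequence $\omega\in\Omega$ such that $Km(\omega^n)\ge n-\sigma(n)$ for all $n$ and, for some computable indicator function $f$, the limit $\lim_{n\to\infty}\frac1n\sum_{i=0}^{n-1}f(T^i\omega)$ does not exist.
   Context: $\Omega=\{0,1\}^\infty$ with the uniform Bernoulli measure $B_{1/2}$ ($B_{1/2}(\Gamma_x)=2^{-l(x)}$ on cylinders). A transformation $T:\Omega\to\Omega$ is computable if it is given by a recursively enumerable set $\hat\psi$ of pairs of strings such that if $(x,y),(x',y')\in\hat\psi$ and $x\subseteq x'$ then $y,y'$ are comparable, $(x,y)\in\hat\psi$ implies $(x,y')\in\hat\psi$ for all prefixes $y'$ of $y$, and $T(\omega)=\sup\{y:x\subseteq\omega,(x,y)\in\hat\psi\}$. Measure preserving: $B_{1/2}(T^{-1}A)=B_{1/2}(A)$ for measurable $A$; ergodic: every invariant set has measure $0$ or $1$. $T^0\omega=\omega$, $T^{i+1}\omega=T(T^i\omega)$; $\omega^n$ is the length-$n$ prefix of $\omega$. $Km$ is monotone Kolmogorov complexity $Km(x)=\min\{l(p):x\subseteq\psi(p)\}$ with respect to a fixed optimal monotone computable decoder $\psi$. *)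

theory Defs
  imports
    "HOL-Probability.Probability"
    "HOL-Library.Nat_Bijection"
    "HOL-Library.Sublist"
    "HOL-Library.Extended_Nat"
begin

section \<open>Partial recursive functions\<close>

text \<open>
  Kleene's schemes. Terms carry no arity: a scheme applied to an argument list that does
  not fit it has no value (and \<open>Zero\<close> accepts every list). This does not enlarge the
  class of functions that can be computed.
\<close>

datatype recf = Zero | Succ | Proj nat | Comp recf "recf list" | PrimRec recf recf | Mu recf

inductive computes :: "recf \<Rightarrow> nat list \<Rightarrow> nat \<Rightarrow> bool" where
  zero: "computes Zero xs 0"
| succ: "computes Succ [x] (Suc x)"
| proj: "i < length xs \<Longrightarrow> computes (Proj i) xs (xs ! i)"
| comp: "list_all2 (\<lambda>g y. computes g xs y) gs ys \<Longrightarrow> computes f ys z \<Longrightarrow>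
         computes (Comp f gs) xs z"
| primrec_0: "computes g xs y \<Longrightarrow> computes (PrimRec g h) (0 # xs) y"
| primrec_Suc: "computes (PrimRec g h) (n # xs) y \<Longrightarrow> computes h (n # y # xs) z \<Longrightarrow>
         computes (PrimRec g h) (Suc n # xs) z"
| mu: "\<forall>i<n. \<exists>y. computes f (i # xs) (Suc y) \<Longrightarrow> computes f (n # xs) 0 \<Longrightarrow>
         computes (Mu f) xs n"

inductive_cases computes_ZeroE: "computes Zero xs y"
inductive_cases computes_SuccE: "computes Succ xs y"
inductive_cases computes_ProjE: "computes (Proj i) xs y"
inductive_cases computes_CompE: "computes (Comp f gs) xs y"
inductive_cases computes_PrimRec_0E: "computes (PrimRec g h) (0 # xs) y"
inductive_cases computes_PrimRec_SucE: "computes (PrimRec g h) (Suc n # xs) y"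
inductive_cases computes_MuE: "computes (Mu f) xs y"

lemma computes_deterministic: "computes f xs y \<Longrightarrow> computes f xs z \<Longrightarrow> y = z"
proof (induction arbitrary: z rule: computes.induct)
  case (zero xs)
  then show ?case by (blast elim: computes_ZeroE)
next
  case (succ x)
  then show ?case by (rule computes_SuccE) simp
next
  case (proj i xs)
  from proj.prems show ?case by (rule computes_ProjE) simp
next
  case (comp xs gs ys f w)
  from comp.prems obtain ys' where ys': "list_all2 (\<lambda>g y. computes g xs y) gs ys'"
    and z: "computes f ys' z"
    by (rule computes_CompE)
  have "ys = ys'"
    using comp.IH(1) ys' by (auto simp: list_all2_conv_all_nth intro!: nth_equalityI)
  with comp.IH(2) z show ?case by blast
next
  case (primrec_0 g xs y h)
  from primrec_0.prems show ?case
    by (rule computes_PrimRec_0E) (use primrec_0.IH in blast)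
next
  case (primrec_Suc g h n xs y w)
  from primrec_Suc.prems show ?case
    by (rule computes_PrimRec_SucE) (use primrec_Suc.IH in blast)
next
  case (mu n f xs)
  from mu.prems have z: "\<forall>i<z. \<exists>y. computes f (i # xs) (Suc y)" "computes f (z # xs) 0"
    by (rule computes_MuE; simp)+
  show ?case
  proof (cases n z rule: linorder_cases)
    case less
    with z(1) obtain y where "computes f (n # xs) (Suc y)" by blast
    with mu.IH(2) show ?thesis by blast
  next
    case greater
    with mu.IH(1) z(2) show ?thesis by blast
  qed
qed

definition computable_nat_fun :: "(nat \<Rightarrow> nat) \<Rightarrow> bool" where
  "computable_nat_fun \<phi> \<longleftrightarrow> (\<exists>f. \<forall>n. computes f [n] (\<phi> n))"

definition re_nat_set :: "nat set \<Rightarrow> bool" where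
  "re_nat_set A \<longleftrightarrow> (\<exists>f. A = {n. \<exists>y. computes f [n] y})"

definition string_code :: "bool list \<Rightarrow> nat" where
  "string_code x = list_encode (map of_bool x)"

definition re_string_pairs :: "(bool list \<times> bool list) set \<Rightarrow> bool" where
  "re_string_pairs P \<longleftrightarrow>
     re_nat_set ((\<lambda>(x, y). prod_encode (string_code x, string_code y)) ` P)"


section \<open>Finite and infinite binary sequences\<close>

datatype bseq = Fin "bool list" | Infin "bool stream"

fun bseq_le :: "bseq \<Rightarrow> bseq \<Rightarrow> bool" (infix \<open>\<sqsubseteq>\<^sub>b\<close> 50) where
  "Fin x \<sqsubseteq>\<^sub>b Fin y \<longleftrightarrow> prefix x y"
| "Fin x \<sqsubseteq>\<^sub>b Infin \<omega> \<longleftrightarrow> stake (length x) \<omega> = x"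
| "Infin \<omega> \<sqsubseteq>\<^sub>b Fin y \<longleftrightarrow> False"
| "Infin \<omega> \<sqsubseteq>\<^sub>b Infin \<omega>' \<longleftrightarrow> \<omega> = \<omega>'"

definition is_bseq_sup :: "bool list set \<Rightarrow> bseq \<Rightarrow> bool" where
  "is_bseq_sup S u \<longleftrightarrow>
     (\<forall>y\<in>S. Fin y \<sqsubseteq>\<^sub>b u) \<and> (\<forall>v. (\<forall>y\<in>S. Fin y \<sqsubseteq>\<^sub>b v) \<longrightarrow> u \<sqsubseteq>\<^sub>b v)"


section \<open>Computable operations on finite and infinite sequences\<close>

definition computable_operation :: "(bool list \<times> bool list) set \<Rightarrow> bool" where
  "computable_operation P \<longleftrightarrow>
     re_string_pairs P \<and>
     (\<forall>x y x' y'. (x, y) \<in> P \<and> (x', y') \<in> P \<and> prefix x x' \<longrightarrow> prefix y y' \<or> prefix y' y) \<and>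
     (\<forall>x y y'. (x, y) \<in> P \<and> prefix y' y \<longrightarrow> (x, y') \<in> P)"

definition operation_outputs :: "(bool list \<times> bool list) set \<Rightarrow> bseq \<Rightarrow> bool list set" where
  "operation_outputs P w = {y. \<exists>x. Fin x \<sqsubseteq>\<^sub>b w \<and> (x, y) \<in> P}"

text \<open>The description is unique and exists for every computable operation, see
  \<open>operation_is_sup\<close> below.\<close>

definition apply_operation :: "(bool list \<times> bool list) set \<Rightarrow> bseq \<Rightarrow> bseq" where
  "apply_operation P w = (THE u. is_bseq_sup (operation_outputs P w) u)"

lemma bseq_le_refl: "u \<sqsubseteq>\<^sub>b u"
  by (cases u) auto

lemma bseq_le_antisym: "u \<sqsubseteq>\<^sub>b v \<Longrightarrow> v \<sqsubseteq>\<^sub>b u \<Longrightarrow> u = v"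
  by (cases u; cases v) auto

lemma prefix_stake_stake: "m \<le> n \<Longrightarrow> prefix (stake m \<omega>) (stake n \<omega>)"
  by (metis le_add_diff_inverse prefixI stake_add)

lemma Fin_le_Fin_linear: "Fin x \<sqsubseteq>\<^sub>b w \<Longrightarrow> Fin x' \<sqsubseteq>\<^sub>b w \<Longrightarrow> prefix x x' \<or> prefix x' x"
proof (cases w)
  case (Fin z)
  assume "Fin x \<sqsubseteq>\<^sub>b w" "Fin x' \<sqsubseteq>\<^sub>b w"
  with Fin show ?thesis by (auto dest: prefix_same_cases)
next
  case (Infin \<omega>)
  assume "Fin x \<sqsubseteq>\<^sub>b w" "Fin x' \<sqsubseteq>\<^sub>b w"
  with Infin show ?thesis
    by (metis bseq_le.simps(2) linorder_linear prefix_stake_stake)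
qed

lemma is_bseq_sup_unique: "is_bseq_sup S u \<Longrightarrow> is_bseq_sup S v \<Longrightarrow> u = v"
  by (meson is_bseq_sup_def bseq_le_antisym)

lemma is_bseq_sup_exists:
  assumes chain: "\<And>y y'. y \<in> S \<Longrightarrow> y' \<in> S \<Longrightarrow> prefix y y' \<or> prefix y' y"
  shows "\<exists>u. is_bseq_sup S u"
proof (cases "\<exists>N. \<forall>y\<in>S. length y \<le> N")
  case True
  show ?thesis
  proof (cases "S = {}")
    case True
    have "is_bseq_sup S (Fin [])"
      unfolding is_bseq_sup_def
    proof (intro conjI allI impI)
      fix v show "Fin [] \<sqsubseteq>\<^sub>b v" by (cases v) auto
    qed (simp add: True)
    then show ?thesis ..
  next
    case False
    then obtain y0 where "y0 \<in> S" by blast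
    moreover from True obtain N where "\<forall>y. y \<in> S \<longrightarrow> length y \<le> N" by blast
    ultimately obtain z where z: "z \<in> S" "\<forall>y\<in>S. length y \<le> length z"
      using ex_has_greatest_nat[of "\<lambda>y. y \<in> S" y0 length "Suc N"]
      by (metis le_imp_less_Suc)
    have "prefix y z" if "y \<in> S" for y
      using chain[OF that z(1)] z(2)[rule_format, OF that]
      by (elim disjE) (auto simp: prefix_def)
    with z(1) have "is_bseq_sup S (Fin z)" by (auto simp: is_bseq_sup_def)
    then show ?thesis ..
  qed
next
  case False
  then have long: "\<exists>y\<in>S. n < length y" for n by (meson not_le)
  define c where "c n = (SOME y. y \<in> S \<and> n < length y)" for n
  have c: "c n \<in> S" "n < length (c n)" for n
    using someI_ex[of "\<lambda>y. y \<in> S \<and> n < length y"] long[of n] by (auto simp: c_def)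
  define \<omega> where "\<omega> = to_stream (\<lambda>n. c n ! n)"
  have nth: "\<omega> !! n = y ! n" if "y \<in> S" "n < length y" for n y
    using chain[OF c(1)[of n] that(1)] c(2)[of n] that(2)
    by (auto simp: \<omega>_def to_stream_def prefix_def nth_append)
  have le: "Fin y \<sqsubseteq>\<^sub>b Infin \<omega>" if "y \<in> S" for y
    using nth[OF that] by (auto intro!: nth_equalityI)
  have "is_bseq_sup S (Infin \<omega>)"
    unfolding is_bseq_sup_def
  proof (intro conjI allI impI ballI)
    fix v assume v: "\<forall>y\<in>S. Fin y \<sqsubseteq>\<^sub>b v"
    show "Infin \<omega> \<sqsubseteq>\<^sub>b v"
    proof (cases v)
      case (Fin z)
      then have "prefix (c (length z)) z" using v c(1) by auto
      then show ?thesis using c(2)[of "length z"] by (auto dest: prefix_length_le)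
    next
      case (Infin \<omega>')
      have "\<omega> !! n = \<omega>' !! n" for n
      proof -
        have "stake (length (c n)) \<omega>' = c n" using v c(1) Infin by auto
        then have "c n ! n = \<omega>' !! n" using stake_nth[OF c(2), of n \<omega>'] by simp
        then show ?thesis using nth[OF c] by simp
      qed
      then have "\<omega> = \<omega>'" using smap_alt[of id \<omega> \<omega>'] by (simp add: stream.map_id)
      with Infin show ?thesis by simp
    qed
  qed (use le in auto)
  then show ?thesis ..
qed

lemma operation_is_sup:
  assumes "computable_operation P"
  shows "is_bseq_sup (operation_outputs P w) (apply_operation P w)"
proof -
  have "prefix y y' \<or> prefix y' y"
    if y: "y \<in> operation_outputs P w" "y' \<in> operation_outputs P w" for y y'
  proof -
    from y obtain x x' where "Fin x \<sqsubseteq>\<^sub>b w" "(x, y) \<in> P" "Fin x' \<sqsubseteq>\<^sub>b w" "(x', y') \<in> P"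
      by (auto simp: operation_outputs_def)
    with Fin_le_Fin_linear[of x w x'] assms show ?thesis
      unfolding computable_operation_def by metis
  qed
  then obtain u where u: "is_bseq_sup (operation_outputs P w) u"
    using is_bseq_sup_exists by blast
  then show ?thesis
    unfolding apply_operation_def by (rule theI) (rule is_bseq_sup_unique[OF _ u])
qed

text \<open>
  A computable transformation is total: the supremum is required to be an infinite sequence
  for every \<open>\<omega>\<close>.
\<close>

definition computable_transformation :: "(bool stream \<Rightarrow> bool stream) \<Rightarrow> bool" where
  "computable_transformation T \<longleftrightarrow>
     (\<exists>P. computable_operation P \<and> (\<forall>\<omega>. Infin (T \<omega>) = apply_operation P (Infin \<omega>)))"


section \<open>Computable real functions of an infinite sequence\<close>

text \<open>
  The set \<open>W\<close> lists quadruples \<open>(x, k, a, b)\<close> asserting that the rational \<open>a / (b + 1)\<close>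
  approximates \<open>f\<close> up to \<open>2\<^sup>-\<^sup>k\<close> on all extensions of \<open>x\<close>; approximations of every precision
  have to be found at every point.
\<close>

definition computable_real_fun :: "(bool stream \<Rightarrow> real) \<Rightarrow> bool" where
  "computable_real_fun f \<longleftrightarrow>
     (\<exists>W :: (bool list \<times> nat \<times> int \<times> nat) set.
        re_nat_set ((\<lambda>(x, k, a, b). prod_encode (string_code x,
           prod_encode (k, prod_encode (int_encode a, b)))) ` W) \<and>
        (\<forall>(x, k, a, b)\<in>W. \<forall>\<omega>. Fin x \<sqsubseteq>\<^sub>b Infin \<omega> \<longrightarrow>
           \<bar>f \<omega> - real_of_int a / real (b + 1)\<bar> \<le> 1 / 2 ^ k) \<and>
        (\<forall>\<omega> k. \<exists>x a b. Fin x \<sqsubseteq>\<^sub>b Infin \<omega> \<and> (x, k, a, b) \<in> W))"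


section \<open>Monotone complexity\<close>

text \<open>The infimum in \<open>enat\<close> is the minimum, or \<open>\<infinity>\<close> if there is no description of \<open>x\<close>.\<close>

definition Km :: "(bool list \<times> bool list) set \<Rightarrow> bool list \<Rightarrow> enat" where
  "Km \<psi> x = (INF p \<in> {p. Fin x \<sqsubseteq>\<^sub>b apply_operation \<psi> (Fin p)}. enat (length p))"

definition optimal_operation :: "(bool list \<times> bool list) set \<Rightarrow> bool" where
  "optimal_operation \<psi> \<longleftrightarrow>
     computable_operation \<psi> \<and>
     (\<forall>\<phi>. computable_operation \<phi> \<longrightarrow> (\<exists>c::nat. \<forall>x. Km \<psi> x \<le> Km \<phi> x + enat c))"


section \<open>The uniform measure and ergodic transformations\<close>

definition bernoulli_half :: "bool stream measure" where
  "bernoulli_half = stream_space (measure_pmf (bernoulli_pmf (1 / 2)))"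

lemma space_bernoulli_half: "space bernoulli_half = UNIV"
  by (simp add: bernoulli_half_def space_stream_space)

lemma sets_cylinder: "{\<omega>. stake (length x) \<omega> = x} \<in> sets bernoulli_half"
proof -
  have "{\<omega> \<in> space (stream_space (count_space UNIV)). stake (length x) \<omega> = (x :: bool list)}
      \<in> sets (stream_space (count_space UNIV))"
    by measurable
  also have "sets (stream_space (count_space UNIV)) = sets bernoulli_half"
    unfolding bernoulli_half_def by (rule sets_stream_space_cong) simp
  finally show ?thesis by (simp add: space_stream_space)
qed

lemma emeasure_cylinder:
  "emeasure bernoulli_half {\<omega>. stake (length x) \<omega> = x} = ennreal ((1 / 2) ^ length x)"
proof (induction x)
  case Nil
  have "prob_space bernoulli_half"
    unfolding bernoulli_half_def by (rule prob_space.prob_space_stream_space[OF prob_space_measure_pmf])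
  then show ?case
    using prob_space.emeasure_space_1[of bernoulli_half] by (simp add: space_bernoulli_half)
next
  case (Cons b x)
  let ?C = "{\<omega>. stake (length x) \<omega> = x}"
  have "emeasure bernoulli_half {\<omega>. stake (length (b # x)) \<omega> = b # x} =
      (\<integral>\<^sup>+t. emeasure bernoulli_half {\<omega>. t = b \<and> \<omega> \<in> ?C} \<partial>measure_pmf (bernoulli_pmf (1 / 2)))"
    using prob_space.emeasure_stream_space[OF prob_space_measure_pmf sets_cylinder[of "b # x", unfolded bernoulli_half_def]]
    by (simp add: bernoulli_half_def space_stream_space)
  also have "\<dots> = (\<integral>\<^sup>+t. emeasure bernoulli_half ?C * indicator {b} t
      \<partial>measure_pmf (bernoulli_pmf (1 / 2)))"
    by (intro nn_integral_cong) (auto split: split_indicator)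
  also have "\<dots> = emeasure bernoulli_half ?C * ennreal (1 / 2)"
    by (subst nn_integral_cmult_indicator) (cases b; simp add: emeasure_pmf_single)+
  also have "\<dots> = ennreal ((1 / 2) ^ length x * (1 / 2))"
    unfolding Cons.IH by (rule ennreal_mult[symmetric]) simp_all
  finally show ?case by (simp only: list.size power_Suc2 add_0_right add_Suc_right One_nat_def)
qed

definition measure_preserving :: "'a measure \<Rightarrow> ('a \<Rightarrow> 'a) \<Rightarrow> bool" where
  "measure_preserving M T \<longleftrightarrow>
     T \<in> M \<rightarrow>\<^sub>M M \<and> (\<forall>A\<in>sets M. emeasure M (T -` A \<inter> space M) = emeasure M A)"

definition ergodic :: "'a measure \<Rightarrow> ('a \<Rightarrow> 'a) \<Rightarrow> bool" where
  "ergodic M T \<longleftrightarrow>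
     (\<forall>A\<in>sets M. T -` A \<inter> space M = A \<longrightarrow> emeasure M A = 0 \<or> emeasure M A = 1)"

end

theory Submission
  imports Defs
begin

text \<open>
  Let \<open>m\<close> be a strictly increasing computable function with \<open>m j > j\<close>, and let \<open>T\<close> select the
  bits at the positions \<open>m 0 < m 1 < \<dots>\<close>. Selecting distinct coordinates of a fair coin
  sequence preserves the measure, and an invariant set is a tail event, so \<open>T\<close> is ergodic by
  Kolmogorov's zero-one law. The first bit of the \<open>i\<close>-th iterate of \<open>T\<close> at \<open>\<omega>\<close> is the bit of
  \<open>\<omega>\<close> at position \<open>q i\<close>, the \<open>i\<close>-th iterate of \<open>m\<close> at \<open>0\<close>. If \<open>m\<close> grows so fast that
  \<open>\<sigma> (m j) > j\<close>, then at most \<open>\<sigma> n\<close> of the positions \<open>q 1, q 2, \<dots>\<close> are below \<open>n\<close>.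
  Prescribing the bits at these positions by a pattern without a density therefore destroys the
  convergence of the averages of the first bit, while it costs at most \<open>\<sigma> n\<close> bits of
  complexity: a Kraft inequality shows that some sequence with the prescribed bits satisfies the
  bound on \<open>Km\<close> without any additive constant.
\<close>

section \<open>Closure properties of the total recursive functions\<close>

text \<open>Only argument lists of length \<open>k\<close> matter, since \<open>recf\<close> terms
  carry no arity. With HOL functions in place of terms, computability follows from the shape of an
  expression by introduction rules.\<close>

definition recfun :: "nat \<Rightarrow> (nat list \<Rightarrow> nat) \<Rightarrow> bool" where
  "recfun k F \<longleftrightarrow> (\<exists>r. \<forall>xs. length xs = k \<longrightarrow> computes r xs (F xs))"

lemma recfun_cong:
  assumes "recfun k F" "\<And>xs. length xs = k \<Longrightarrow> F xs = G xs"
  shows "recfun k G"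
  using assms unfolding recfun_def by metis

lemma recfun_1_iff: "recfun 1 F \<longleftrightarrow> computable_nat_fun (\<lambda>n. F [n])"
  unfolding recfun_def computable_nat_fun_def by (auto simp: length_Suc_conv)

lemma recfun_proj: "i < k \<Longrightarrow> recfun k (\<lambda>xs. xs ! i)"
  unfolding recfun_def by (auto intro: computes.proj)

lemma recfun_comp:
  assumes F: "recfun (length Gs) F" and Gs: "\<And>G. G \<in> set Gs \<Longrightarrow> recfun k G"
  shows "recfun k (\<lambda>xs. F (map (\<lambda>G. G xs) Gs))"
proof -
  obtain r where r: "\<And>xs. length xs = length Gs \<Longrightarrow> computes r xs (F xs)"
    using F unfolding recfun_def by blast
  obtain s where s: "\<And>G xs. G \<in> set Gs \<Longrightarrow> length xs = k \<Longrightarrow> computes (s G) xs (G xs)"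
    using Gs unfolding recfun_def by metis
  have "computes (Comp r (map s Gs)) xs (F (map (\<lambda>G. G xs) Gs))" if "length xs = k" for xs
  proof (rule computes.comp)
    show "list_all2 (\<lambda>g y. computes g xs y) (map s Gs) (map (\<lambda>G. G xs) Gs)"
      using s that by (auto simp: list_all2_conv_all_nth)
    show "computes r (map (\<lambda>G. G xs) Gs) (F (map (\<lambda>G. G xs) Gs))"
      by (rule r) simp
  qed
  then show ?thesis unfolding recfun_def by blast
qed

lemma recfun_app1:
  assumes "recfun 1 (\<lambda>xs. \<phi> (xs ! 0))" "recfun k G"
  shows "recfun k (\<lambda>xs. \<phi> (G xs))"
  using recfun_comp[of "[G]" "\<lambda>xs. \<phi> (xs ! 0)" k] assms by simp

lemma recfun_Suc:
  assumes "recfun k G"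
  shows "recfun k (\<lambda>xs. Suc (G xs))"
proof (rule recfun_app1[where \<phi> = Suc, OF _ assms])
  show "recfun 1 (\<lambda>xs. Suc (xs ! 0))"
    unfolding recfun_1_iff computable_nat_fun_def by (auto intro: computes.succ)
qed

lemma recfun_const: "recfun k (\<lambda>xs. c)"
proof (induction c)
  case 0
  show ?case unfolding recfun_def by (auto intro: computes.zero)
qed (rule recfun_Suc)

lemma recfun_primrec:
  assumes g: "recfun k g" and h: "recfun (Suc (Suc k)) h"
  shows "recfun (Suc k) (\<lambda>ys. rec_nat (g (tl ys)) (\<lambda>n y. h (n # y # tl ys)) (hd ys))"
proof -
  obtain r s where r: "\<And>xs. length xs = k \<Longrightarrow> computes r xs (g xs)"
    and s: "\<And>xs. length xs = Suc (Suc k) \<Longrightarrow> computes s xs (h xs)"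
    using g h unfolding recfun_def by blast
  have "computes (PrimRec r s) (n # xs) (rec_nat (g xs) (\<lambda>n y. h (n # y # xs)) n)"
    if "length xs = k" for n xs
  proof (induction n)
    case 0
    show ?case using r[OF that] by (auto intro: computes.primrec_0)
  next
    case (Suc n)
    then show ?case using s that by (auto intro: computes.primrec_Suc)
  qed
  then show ?thesis
    unfolding recfun_def by (intro exI[of _ "PrimRec r s"]) (auto simp: length_Suc_conv)
qed

text \<open>\<open>PrimRec\<close> recurses on the head of its argument list. Composing it with
  \<open>G\<close> and all \<open>k\<close> projections lets the recursion depth be any recursive
  function of the parameters.\<close>

lemma recfun_rec_nat:
  assumes g: "recfun k g" and h: "recfun (Suc (Suc k)) h" and G: "recfun k G"
  shows "recfun k (\<lambda>xs. rec_nat (g xs) (\<lambda>n y. h (n # y # xs)) (G xs))"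
proof -
  let ?F = "\<lambda>ys. rec_nat (g (tl ys)) (\<lambda>n y. h (n # y # tl ys)) (hd ys)"
  let ?Gs = "G # map (\<lambda>i xs. xs ! i) [0..<k]"
  have "recfun k (\<lambda>xs. ?F (map (\<lambda>G. G xs) ?Gs))"
    using recfun_primrec[OF g h] G by (intro recfun_comp) (auto intro: recfun_proj)
  then show ?thesis
  proof (rule recfun_cong)
    fix xs :: "nat list"
    assume "length xs = k"
    then have "map (\<lambda>i. xs ! i) [0..<k] = xs" by (auto intro: map_nth)
    then show "?F (map (\<lambda>G. G xs) ?Gs) = rec_nat (g xs) (\<lambda>n y. h (n # y # xs)) (G xs)"
      by (simp add: comp_def)
  qed
qed

text \<open>\<open>Mu\<close> needs a value at every argument below the result, which totality of
  \<open>F\<close> supplies; \<open>ex\<close> makes the search stop.\<close>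

lemma recfun_Least:
  assumes F: "recfun (Suc k) F" and ex: "\<And>xs. length xs = k \<Longrightarrow> \<exists>n. F (n # xs) = 0"
  shows "recfun k (\<lambda>xs. LEAST n. F (n # xs) = 0)"
proof -
  obtain r where r: "\<And>xs. length xs = Suc k \<Longrightarrow> computes r xs (F xs)"
    using F unfolding recfun_def by blast
  have "computes (Mu r) xs (LEAST n. F (n # xs) = 0)" if xs: "length xs = k" for xs
  proof (rule computes.mu)
    show "\<forall>i<LEAST n. F (n # xs) = 0. \<exists>y. computes r (i # xs) (Suc y)"
    proof (intro allI impI)
      fix i assume "i < (LEAST n. F (n # xs) = 0)"
      then have "F (i # xs) \<noteq> 0" by (rule not_less_Least)
      then show "\<exists>y. computes r (i # xs) (Suc y)"
        using r[of "i # xs"] xs by (metis length_Cons not0_implies_Suc)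
    qed
    show "computes r ((LEAST n. F (n # xs) = 0) # xs) 0"
      using r[of "(LEAST n. F (n # xs) = 0) # xs"] xs LeastI_ex[OF ex[OF xs]] by simp
  qed
  then show ?thesis unfolding recfun_def by blast
qed

text \<open>Iteration is a primitive recursion whose step ignores the counter at index 0 and applies
  \<open>t\<close> to the previous value at index 1. Addition, truncated subtraction and iterated
  tails of list codes are instances.\<close>

lemma recfun_funpow:
  assumes "recfun 1 (\<lambda>xs. t (xs ! 0))" "recfun k G" "recfun k H"
  shows "recfun k (\<lambda>xs. (t ^^ G xs) (H xs))"
proof -
  have "recfun k (\<lambda>xs. rec_nat (H xs) (\<lambda>n y. t ((n # y # xs) ! 1)) (G xs))"
    by (rule recfun_rec_nat[where h = "\<lambda>zs. t (zs ! 1)"])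
      (auto intro!: recfun_app1[where \<phi> = t, OF assms(1)] recfun_proj assms)
  moreover have "rec_nat (H xs) (\<lambda>n y. t ((n # y # xs) ! 1)) m = (t ^^ m) (H xs)" for xs m
    by (induction m) auto
  ultimately show ?thesis by simp
qed

lemma recfun_add:
  assumes "recfun k G" "recfun k H"
  shows "recfun k (\<lambda>xs. G xs + H xs)"
proof -
  have "recfun k (\<lambda>xs. (Suc ^^ G xs) (H xs))"
    by (rule recfun_funpow[where t = Suc]) (auto intro!: recfun_Suc recfun_proj assms)
  then show ?thesis by simp
qed

lemma recfun_diff:
  assumes "recfun k G" "recfun k H"
  shows "recfun k (\<lambda>xs. G xs - H xs)"
proof -
  \<comment> \<open>The predecessor comes from a recursion whose step returns the counter and
    discards the previous value.\<close>
  have *: "recfun 1 (\<lambda>xs. xs ! 0 - 1)"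
  proof -
    have "recfun 1 (\<lambda>xs. rec_nat 0 (\<lambda>n y. (n # y # xs) ! 0) (xs ! 0))"
      by (intro recfun_rec_nat[where h = "\<lambda>zs. zs ! 0"] recfun_proj recfun_const) simp_all
    moreover have "rec_nat 0 (\<lambda>n y. (n # y # xs) ! 0) m = m - 1" for xs :: "nat list" and m
      by (cases m) auto
    ultimately show ?thesis by simp
  qed
  have "((\<lambda>n. n - 1) ^^ i) m = m - i" for i m :: nat
    by (induction i) auto
  then show ?thesis
    using recfun_funpow[where t = "\<lambda>n. n - 1", OF * assms(2,1)] by simp
qed

definition decidable :: "nat \<Rightarrow> (nat list \<Rightarrow> bool) \<Rightarrow> bool" where
  "decidable k P \<longleftrightarrow> recfun k (\<lambda>xs. of_bool (P xs))"

lemma decidable_not: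
  assumes "decidable k P"
  shows "decidable k (\<lambda>xs. \<not> P xs)"
proof -
  have "recfun k (\<lambda>xs. 1 - of_bool (P xs))"
    using assms unfolding decidable_def by (intro recfun_diff recfun_const)
  then show ?thesis unfolding decidable_def by (rule recfun_cong) auto
qed

lemma decidable_conj:
  assumes "decidable k P" "decidable k Q"
  shows "decidable k (\<lambda>xs. P xs \<and> Q xs)"
proof -
  have "recfun k (\<lambda>xs. (of_bool (P xs) + of_bool (Q xs)) - 1)"
    using assms unfolding decidable_def by (intro recfun_diff recfun_add recfun_const)
  then show ?thesis unfolding decidable_def by (rule recfun_cong) auto
qed

lemma decidable_disj:
  assumes "decidable k P" "decidable k Q"
  shows "decidable k (\<lambda>xs. P xs \<or> Q xs)"
  using decidable_not[OF decidable_conj[OF assms[THEN decidable_not]]] by simp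

lemma decidable_le:
  assumes "recfun k G" "recfun k H"
  shows "decidable k (\<lambda>xs. G xs \<le> H xs)"
proof -
  have "recfun k (\<lambda>xs. 1 - (G xs - H xs))"
    using assms by (intro recfun_diff recfun_const)
  then show ?thesis unfolding decidable_def by (rule recfun_cong) auto
qed

lemma decidable_less:
  assumes "recfun k G" "recfun k H"
  shows "decidable k (\<lambda>xs. G xs < H xs)"
  using decidable_not[OF decidable_le[OF assms(2,1)]] by (simp add: not_le)

lemma decidable_eq:
  assumes "recfun k G" "recfun k H"
  shows "decidable k (\<lambda>xs. G xs = H xs)"
  using decidable_conj[OF decidable_le[OF assms] decidable_le[OF assms(2,1)]]
  by (simp add: order.eq_iff)

text \<open>The conjunction is accumulated by primitive recursion: on truth values,
  \<open>a + b - 1\<close> with truncated subtraction is the conjunction.\<close>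

lemma decidable_ball:
  assumes P: "decidable (Suc k) P" and G: "recfun k G"
  shows "decidable k (\<lambda>xs. \<forall>i<G xs. P (i # xs))"
proof -
  let ?h = "\<lambda>zs. (zs ! 1 + of_bool (P (zs ! 0 # drop 2 zs))) - 1 :: nat"
  \<comment> \<open>The step function receives the counter, the accumulator and then the parameters;
    the accumulator at index 1 has to be removed before \<open>P\<close> applies.\<close>
  have P': "recfun (Suc (Suc k)) (\<lambda>zs. of_bool (P (zs ! 0 # drop 2 zs)))"
  proof (rule recfun_cong)
    let ?Gs = "(\<lambda>zs. zs ! 0) # map (\<lambda>i zs. zs ! (i + 2)) [0..<k]"
    show "recfun (Suc (Suc k)) (\<lambda>zs. of_bool (P (map (\<lambda>G. G zs) ?Gs)))"
    proof (rule recfun_comp)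
      show "recfun (length ?Gs) (\<lambda>xs. of_bool (P xs))"
        using P by (simp add: decidable_def)
      show "recfun (Suc (Suc k)) G" if "G \<in> set ?Gs" for G
        using that by (auto intro!: recfun_proj)
    qed
    fix zs :: "nat list"
    assume "length zs = Suc (Suc k)"
    then have "map (\<lambda>i. zs ! (i + 2)) [0..<k] = drop 2 zs"
      by (auto intro!: nth_equalityI)
    then show "of_bool (P (map (\<lambda>G. G zs) ?Gs)) = of_bool (P (zs ! 0 # drop 2 zs))"
      by (simp add: comp_def)
  qed
  have "recfun k (\<lambda>xs. rec_nat 1 (\<lambda>n y. ?h (n # y # xs)) (G xs))"
    by (rule recfun_rec_nat[where h = ?h])
      (auto intro!: recfun_diff recfun_add recfun_proj recfun_const P' G)
  moreover have "rec_nat 1 (\<lambda>n y. ?h (n # y # xs)) m = of_bool (\<forall>i<m. P (i # xs))" for xs m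
    by (induction m) (auto simp: less_Suc_eq)
  ultimately show ?thesis unfolding decidable_def by simp
qed

lemma recfun_LEAST:
  assumes P: "decidable (Suc k) P" and ex: "\<And>xs. length xs = k \<Longrightarrow> \<exists>n. P (n # xs)"
  shows "recfun k (\<lambda>xs. LEAST n. P (n # xs))"
proof -
  have "recfun k (\<lambda>xs. LEAST n. of_bool (\<not> P (n # xs)) = (0::nat))"
    by (rule recfun_Least[where F = "\<lambda>xs. of_bool (\<not> P xs)"])
      (use decidable_not[OF P] ex in \<open>auto simp: decidable_def\<close>)
  then show ?thesis by simp
qed

text \<open>The set is the domain of an unbounded search whose test ignores the search variable: the
  search stops at 0 if \<open>P n\<close> holds and never stops otherwise.\<close>

lemma re_nat_set_if_decidable:
  assumes "decidable 1 (\<lambda>xs. P (xs ! 0))"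
  shows "re_nat_set {n. P n}"
proof -
  have "decidable 2 (\<lambda>xs. P (xs ! 1))"
    unfolding decidable_def
    by (rule recfun_app1[where \<phi> = "\<lambda>n. of_bool (P n)", OF assms[unfolded decidable_def]])
      (rule recfun_proj, simp)
  from decidable_not[OF this] obtain r where
    r: "\<And>xs. length xs = 2 \<Longrightarrow> computes r xs (of_bool (\<not> P (xs ! 1)))"
    unfolding decidable_def recfun_def by blast
  have r': "computes r [i, n] (of_bool (\<not> P n))" for i n
    using r[of "[i, n]"] by simp
  have "P n \<longleftrightarrow> (\<exists>y. computes (Mu r) [n] y)" for n
  proof
    assume "P n"
    then have "computes (Mu r) [n] 0" using r'[of 0 n] by (intro computes.mu) auto
    then show "\<exists>y. computes (Mu r) [n] y" ..
  next
    assume "\<exists>y. computes (Mu r) [n] y"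
    then obtain y where "computes r [y, n] 0" by (auto elim: computes_MuE)
    with computes_deterministic[OF r'] show "P n" by fastforce
  qed
  then show ?thesis unfolding re_nat_set_def by blast
qed

section \<open>Recursive decoding of pairs, lists and binary strings\<close>

lemma recfun_triangle:
  assumes "recfun k G"
  shows "recfun k (\<lambda>xs. triangle (G xs))"
proof (rule recfun_app1[where \<phi> = triangle, OF _ assms])
  have "recfun 1 (\<lambda>xs. rec_nat 0 (\<lambda>n y. (n # y # xs) ! 1 + Suc ((n # y # xs) ! 0)) (xs ! 0))"
    by (rule recfun_rec_nat[where h = "\<lambda>zs. zs ! 1 + Suc (zs ! 0)"])
      (auto intro!: recfun_proj recfun_const recfun_add recfun_Suc)
  moreover have "rec_nat 0 (\<lambda>n y. (n # y # xs) ! 1 + Suc ((n # y # xs) ! 0)) m = triangle m"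
    for xs :: "nat list" and m
    by (induction m) auto
  ultimately show "recfun 1 (\<lambda>xs. triangle (xs ! 0))" by simp
qed

text \<open>The code of \<open>(a, b)\<close> is \<open>triangle (a + b) + a\<close>, so the codes
  with a fixed sum \<open>a + b\<close> fill the interval between two successive triangular numbers.
  Searching for the interval recovers the sum, and the offset in it is \<open>a\<close>.\<close>

lemma prod_decode_eq_Least:
  fixes c :: nat
  defines "s \<equiv> LEAST s. c < triangle (Suc s)"
  shows "prod_decode c = (c - triangle s, s - (c - triangle s))"
proof -
  obtain a b where ab: "prod_decode c = (a, b)" by fastforce
  then have c: "c = triangle (a + b) + a"
    using prod_decode_inverse[of c] by (simp add: prod_encode_def)
  have mono: "triangle i \<le> triangle j" if "i \<le> j" for i j
    using that by (induction j) (auto simp: le_Suc_eq)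
  have "s = a + b"
    unfolding s_def
  proof (rule Least_equality)
    show "c < triangle (Suc (a + b))" by (simp add: c)
    fix t assume "c < triangle (Suc t)"
    show "a + b \<le> t"
    proof (rule ccontr)
      assume "\<not> a + b \<le> t"
      then have "triangle (Suc t) \<le> triangle (a + b)" by (intro mono) simp
      with \<open>c < triangle (Suc t)\<close> c show False by simp
    qed
  qed
  then show ?thesis using ab by (simp add: c)
qed

lemma recfun_fst_prod_decode:
    "recfun k G \<Longrightarrow> recfun k (\<lambda>xs. fst (prod_decode (G xs)))" (is "_ \<Longrightarrow> ?fst")
  and recfun_snd_prod_decode:
    "recfun k G \<Longrightarrow> recfun k (\<lambda>xs. snd (prod_decode (G xs)))" (is "_ \<Longrightarrow> ?snd")
proof -
  assume G: "recfun k G"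
  have "recfun 1 (\<lambda>xs. LEAST s. (s # xs) ! 1 < triangle (Suc ((s # xs) ! 0)))"
  proof (rule recfun_LEAST[where P = "\<lambda>xs. xs ! 1 < triangle (Suc (xs ! 0))"])
    show "decidable (Suc 1) (\<lambda>xs. xs ! 1 < triangle (Suc (xs ! 0)))"
      by (intro decidable_less recfun_triangle recfun_Suc recfun_proj) auto
    show "\<exists>s. (s # xs) ! 1 < triangle (Suc ((s # xs) ! 0))" for xs :: "nat list"
      by (auto intro!: exI[of _ "xs ! 0"])
  qed
  then have "recfun 1 (\<lambda>xs. LEAST s. xs ! 0 < triangle (Suc s))" by simp
  from recfun_app1[where \<phi> = "\<lambda>n. LEAST s. n < triangle (Suc s)", OF this G] have s: "recfun k (\<lambda>xs. LEAST s. G xs < triangle (Suc s))" .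
  show ?fst ?snd
    unfolding prod_decode_eq_Least fst_conv snd_conv
    by (intro recfun_diff recfun_triangle s G)+
qed

text \<open>The code of a nonempty list is the successor of a pair code, which \<open>c - 1\<close>
  undoes. On 0, the code of the empty list, both \<open>code_hd\<close> and \<open>code_tl\<close>
  return 0, so iterated tails stay at 0 past the end of a list.\<close>

definition code_hd :: "nat \<Rightarrow> nat" where
  "code_hd c = fst (prod_decode (c - 1))"

definition code_tl :: "nat \<Rightarrow> nat" where
  "code_tl c = snd (prod_decode (c - 1))"

lemma prod_decode_0: "prod_decode 0 = (0, 0)"
  using prod_encode_inverse[of "(0, 0)"] by (simp add: prod_encode_def)

lemma code_tl_list_encode: "code_tl (list_encode xs) = list_encode (tl xs)"
  by (cases xs) (auto simp: code_tl_def prod_decode_0)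

lemma code_tl_funpow: "(code_tl ^^ i) (list_encode xs) = list_encode (drop i xs)"
  by (induction i) (auto simp: code_tl_list_encode drop_Suc tl_drop)

lemma list_encode_eq_0_iff: "list_encode xs = 0 \<longleftrightarrow> xs = []"
  by (cases xs) auto

lemma code_hd_drop: "i < length xs \<Longrightarrow> code_hd (list_encode (drop i xs)) = xs ! i"
  by (cases "drop i xs") (auto simp: code_hd_def hd_drop_conv_nth[symmetric])

text \<open>This makes quantifiers over list positions bounded by the code itself, hence
  decidable.\<close>

lemma length_le_list_encode: "length xs \<le> list_encode xs"
proof (induction xs)
  case (Cons x xs)
  then show ?case using le_prod_encode_2[of "list_encode xs" x] by simp
qed simp

lemma recfun_code_tl_funpow:
  assumes "recfun k G" "recfun k H"
  shows "recfun k (\<lambda>xs. (code_tl ^^ G xs) (H xs))"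
  by (rule recfun_funpow[where t = code_tl])
    (auto simp: code_tl_def
      intro!: recfun_snd_prod_decode recfun_diff recfun_const recfun_proj assms)

lemma recfun_code_hd: "recfun k G \<Longrightarrow> recfun k (\<lambda>xs. code_hd (G xs))"
  unfolding code_hd_def by (intro recfun_fst_prod_decode recfun_diff recfun_const)

text \<open>A tail code 0 means that position \<open>i\<close> lies past the end. The bound
  \<open>c\<close> is at least the length of the coded list, so all entries are tested.\<close>

definition is_string_code :: "nat \<Rightarrow> bool" where
  "is_string_code c \<longleftrightarrow> (\<forall>i<c. (code_tl ^^ i) c = 0 \<or> code_hd ((code_tl ^^ i) c) \<le> 1)"

lemma string_code_drop: "(code_tl ^^ i) (string_code x) = string_code (drop i x)"
  by (simp add: string_code_def code_tl_funpow drop_map)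

lemma string_code_eq_0_iff: "string_code x = 0 \<longleftrightarrow> x = []"
  by (simp add: string_code_def list_encode_eq_0_iff)

lemma code_hd_string_code:
  "i < length x \<Longrightarrow> code_hd (string_code (drop i x)) = of_bool (x ! i)"
  using code_hd_drop[of i "map of_bool x"] by (simp add: string_code_def drop_map)

lemma length_le_string_code: "length x \<le> string_code x"
  using length_le_list_encode[of "map of_bool x"] by (simp add: string_code_def)

lemma is_string_code_iff: "is_string_code c \<longleftrightarrow> c \<in> range string_code"
proof
  assume c: "is_string_code c"
  define xs where "xs = list_decode c"
  have xs: "c = list_encode xs" by (simp add: xs_def)
  have "xs ! i \<le> 1" if "i < length xs" for i
    using c that length_le_list_encode[of xs]
    by (auto simp: is_string_code_def xs code_tl_funpow list_encode_eq_0_iff code_hd_drop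
        dest!: spec[of _ i])
  then have "map (of_bool \<circ> (\<lambda>v. v = 1)) xs = xs"
    by (intro nth_equalityI) (auto simp: le_Suc_eq)
  then have "c = string_code (map (\<lambda>v. v = 1) xs)"
    unfolding string_code_def xs by simp
  then show "c \<in> range string_code" by blast
next
  assume "c \<in> range string_code"
  then obtain x where x: "c = string_code x" by blast
  have "string_code (drop i x) = 0 \<or> code_hd (string_code (drop i x)) \<le> 1" for i
    by (cases "i < length x") (auto simp: string_code_eq_0_iff code_hd_string_code)
  then show "is_string_code c" by (simp add: is_string_code_def x string_code_drop)
qed

lemma decidable_is_string_code:
  assumes "recfun k G"
  shows "decidable k (\<lambda>xs. is_string_code (G xs))"
proof -
  have "decidable 1 (\<lambda>xs. \<forall>i<xs ! 0. (code_tl ^^ ((i # xs) ! 0)) ((i # xs) ! 1) = 0 \<or>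
      code_hd ((code_tl ^^ ((i # xs) ! 0)) ((i # xs) ! 1)) \<le> 1)"
    by (rule decidable_ball[where P = "\<lambda>zs. (code_tl ^^ (zs ! 0)) (zs ! 1) = 0 \<or>
          code_hd ((code_tl ^^ (zs ! 0)) (zs ! 1)) \<le> 1"])
      (auto intro!: decidable_disj decidable_eq decidable_le recfun_code_hd
        recfun_code_tl_funpow recfun_proj recfun_const simp del: funpow.simps)
  then have "recfun 1 (\<lambda>xs. of_bool (is_string_code (xs ! 0)))"
    by (simp add: is_string_code_def decidable_def)
  from recfun_app1[where \<phi> = "\<lambda>n. of_bool (is_string_code n)", OF this assms] show ?thesis by (simp add: decidable_def)
qed

section \<open>Selecting a computable subsequence of the bits\<close>

definition subseq_stream :: "(nat \<Rightarrow> nat) \<Rightarrow> 'a stream \<Rightarrow> 'a stream" where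
  "subseq_stream m \<omega> = to_stream (\<lambda>j. \<omega> !! m j)"

lemma snth_subseq_stream [simp]: "subseq_stream m \<omega> !! j = \<omega> !! m j"
  by (simp add: subseq_stream_def to_stream_def)

definition subseq_operation :: "(nat \<Rightarrow> nat) \<Rightarrow> (bool list \<times> bool list) set" where
  "subseq_operation m = {(x, y). \<forall>j<length y. m j < length x \<and> y ! j = x ! m j}"

text \<open>The set of codes is even decidable: bits are read off the codes by iterated tails, and
  only positions below the code of the output need to be checked.\<close>

lemma re_subseq_operation:
  assumes m: "computable_nat_fun m"
  shows "re_string_pairs (subseq_operation m)"
proof -
  \<comment> \<open>For codes \<open>X\<close>, \<open>Y\<close> of \<open>x\<close>,
    \<open>y\<close>: either \<open>j\<close> is past the end of \<open>y\<close>, or position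
    \<open>m j\<close> lies inside \<open>x\<close> and the two bits agree.\<close>
  define sel where "sel X Y j \<longleftrightarrow> (code_tl ^^ j) Y = 0 \<or> (0 < (code_tl ^^ m j) X \<and>
    code_hd ((code_tl ^^ j) Y) = code_hd ((code_tl ^^ m j) X))" for X Y j
  define D where "D n \<longleftrightarrow> is_string_code (fst (prod_decode n)) \<and>
    is_string_code (snd (prod_decode n)) \<and>
    (\<forall>j<snd (prod_decode n). sel (fst (prod_decode n)) (snd (prod_decode n)) j)" for n
  have m': "recfun 1 (\<lambda>xs. m (xs ! 0))" using m by (simp add: recfun_1_iff del: One_nat_def)
  have "decidable 1 (\<lambda>xs. \<forall>j<snd (prod_decode (xs ! 0)).
      sel (fst (prod_decode ((j # xs) ! 1))) (snd (prod_decode ((j # xs) ! 1))) ((j # xs) ! 0))"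
    by (rule decidable_ball[where P = "\<lambda>zs. sel (fst (prod_decode (zs ! 1)))
          (snd (prod_decode (zs ! 1))) (zs ! 0)"])
      (auto simp: sel_def intro!: decidable_disj decidable_conj decidable_less decidable_eq
        recfun_code_hd recfun_code_tl_funpow recfun_fst_prod_decode recfun_snd_prod_decode
        recfun_proj recfun_const recfun_app1[where \<phi> = m, OF m'])
  then have "decidable 1 (\<lambda>xs. \<forall>j<snd (prod_decode (xs ! 0)).
      sel (fst (prod_decode (xs ! 0))) (snd (prod_decode (xs ! 0))) j)" by simp
  then have "decidable 1 (\<lambda>xs. D (xs ! 0))"
    unfolding D_def by (intro decidable_conj decidable_is_string_code recfun_fst_prod_decode
        recfun_snd_prod_decode recfun_proj) auto
  then have re: "re_nat_set {n. D n}" by (rule re_nat_set_if_decidable)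
  have sel: "(\<forall>j<string_code y. sel (string_code x) (string_code y) j) \<longleftrightarrow>
      (x, y) \<in> subseq_operation m" for x y
  proof -
    have "sel (string_code x) (string_code y) j \<longleftrightarrow>
        (j < length y \<longrightarrow> m j < length x \<and> y ! j = x ! m j)" for j
      by (cases "j < length y"; cases "m j < length x")
        (auto simp: sel_def string_code_drop string_code_eq_0_iff code_hd_string_code
          simp flip: neq0_conv)
    moreover have "j < string_code y" if "j < length y" for j
      using that length_le_string_code[of y] by simp
    ultimately show ?thesis by (auto simp: subseq_operation_def)
  qed
  have "(\<lambda>(x, y). prod_encode (string_code x, string_code y)) ` subseq_operation m = {n. D n}"
  proof (intro equalityI subsetI)
    fix n assume "n \<in> {n. D n}"
    then obtain x y where "prod_decode n = (string_code x, string_code y)"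
      and "(x, y) \<in> subseq_operation m"
      unfolding D_def is_string_code_iff mem_Collect_eq
      by (metis (no_types, lifting) imageE prod.collapse sel)
    then show "n \<in> (\<lambda>(x, y). prod_encode (string_code x, string_code y)) ` subseq_operation m"
      by (intro image_eqI[of _ _ "(x, y)"]) (auto, metis prod_decode_inverse)
  next
    fix n assume "n \<in> (\<lambda>(x, y). prod_encode (string_code x, string_code y)) ` subseq_operation m"
    then obtain x y where n: "n = prod_encode (string_code x, string_code y)"
      and "(x, y) \<in> subseq_operation m" by auto
    then have "\<forall>j<string_code y. sel (string_code x) (string_code y) j" by (simp add: sel)
    then show "n \<in> {n. D n}" by (simp add: n D_def is_string_code_iff)
  qed
  with re show ?thesis by (simp add: re_string_pairs_def)
qed

lemma computable_subseq_operation: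
  assumes "computable_nat_fun m"
  shows "computable_operation (subseq_operation m)"
  unfolding computable_operation_def
proof (intro conjI allI impI re_subseq_operation[OF assms])
  fix x y x' y' :: "bool list"
  assume *: "(x, y) \<in> subseq_operation m \<and> (x', y') \<in> subseq_operation m \<and> prefix x x'"
  \<comment> \<open>Both bits are the bit of \<open>x'\<close> at position \<open>m j\<close>,
    because \<open>x\<close> is a prefix of \<open>x'\<close>.\<close>
  then have eq: "y ! j = y' ! j" if "j < length y" "j < length y'" for j
    using that by (auto simp: subseq_operation_def prefix_def nth_append)
  show "prefix y y' \<or> prefix y' y"
  proof (cases "length y \<le> length y'")
    case True
    then have "y = take (length y) y'" using eq by (intro nth_equalityI) auto
    then show ?thesis by (metis take_is_prefix)
  next
    case False
    then have "y' = take (length y') y" using eq by (intro nth_equalityI) auto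
    then show ?thesis by (metis take_is_prefix)
  qed
next
  fix x y y' :: "bool list"
  assume "(x, y) \<in> subseq_operation m \<and> prefix y' y"
  then show "(x, y') \<in> subseq_operation m"
    unfolding subseq_operation_def prefix_def by clarsimp (metis nth_append trans_less_add1)
qed

lemma stake_eq_iff: "stake (length x) \<omega> = x \<longleftrightarrow> (\<forall>j<length x. \<omega> !! j = x ! j)"
  by (auto simp: list_eq_iff_nth_eq)

lemma stream_eqI: "(\<And>j. \<omega> !! j = \<omega>' !! j) \<Longrightarrow> \<omega> = \<omega>'"
  using smap_alt[of id \<omega> \<omega>'] by (simp add: stream.map_id)

lemma computable_subseq_stream:
  assumes m: "computable_nat_fun m"
  shows "computable_transformation (subseq_stream m)"
  unfolding computable_transformation_def
proof (intro exI conjI allI)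
  show P: "computable_operation (subseq_operation m)"
    by (rule computable_subseq_operation[OF m])
  fix \<omega>
  let ?S = "operation_outputs (subseq_operation m) (Infin \<omega>)"
  have sound: "stake (length y) (subseq_stream m \<omega>) = y" if "y \<in> ?S" for y
    using that by (auto simp: operation_outputs_def subseq_operation_def stake_eq_iff)
  have complete: "stake n (subseq_stream m \<omega>) \<in> ?S" for n
  proof -
    \<comment> \<open>The sum is a crude bound for all input positions that the first
      \<open>n\<close> output bits read.\<close>
    let ?N = "Suc (\<Sum>j<n. m j)"
    have "m j < ?N" if "j < n" for j
      using that member_le_sum[of j "{..<n}" m] by simp
    then have "(stake ?N \<omega>, stake n (subseq_stream m \<omega>)) \<in> subseq_operation m"
      by (auto simp: subseq_operation_def simp del: stake.simps)
    moreover have "Fin (stake ?N \<omega>) \<sqsubseteq>\<^sub>b Infin \<omega>" by (simp del: stake.simps)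
    ultimately show ?thesis unfolding operation_outputs_def by blast
  qed
  have "is_bseq_sup ?S (Infin (subseq_stream m \<omega>))"
    unfolding is_bseq_sup_def
  proof (intro conjI ballI allI impI)
    fix v assume v: "\<forall>y\<in>?S. Fin y \<sqsubseteq>\<^sub>b v"
    show "Infin (subseq_stream m \<omega>) \<sqsubseteq>\<^sub>b v"
    proof (cases v)
      \<comment> \<open>Impossible: the outputs include prefixes longer than
        \<open>z\<close>.\<close>
      case (Fin z)
      with v complete have "prefix (stake (Suc (length z)) (subseq_stream m \<omega>)) z"
        by (metis bseq_le.simps(1))
      then show ?thesis using prefix_length_le by fastforce
    next
      case (Infin \<omega>')
      have "subseq_stream m \<omega> !! j = \<omega>' !! j" for j
      proof -
        have "Fin (stake (Suc j) (subseq_stream m \<omega>)) \<sqsubseteq>\<^sub>b Infin \<omega>'"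
          using v complete Infin by blast
        then show ?thesis
          by (metis bseq_le.simps(2) length_stake lessI stake_nth)
      qed
      then have "subseq_stream m \<omega> = \<omega>'" by (rule stream_eqI)
      with Infin show ?thesis by simp
    qed
  qed (use sound in auto)
  then show "Infin (subseq_stream m \<omega>) = apply_operation (subseq_operation m) (Infin \<omega>)"
    using operation_is_sup[OF P] is_bseq_sup_unique by blast
qed

text \<open>One bit of the input determines the value exactly, so the same approximation serves
  every precision.\<close>

lemma computable_real_fun_shd: "computable_real_fun (\<lambda>\<omega>. of_bool (shd \<omega>))"
proof -
  define W :: "(bool list \<times> nat \<times> int \<times> nat) set" where
    "W = {(x, k, a, b). \<exists>c. x = [c] \<and> a = of_bool c \<and> b = 0}"
  \<comment> \<open>The precision component is left free. The 0 in the first disjunct is the code of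
    the fraction with numerator 0 and denominator 1.\<close>
  define D where "D n \<longleftrightarrow>
    fst (prod_decode n) = string_code [False] \<and> snd (prod_decode (snd (prod_decode n))) = 0 \<or>
    fst (prod_decode n) = string_code [True] \<and>
      snd (prod_decode (snd (prod_decode n))) = prod_encode (int_encode 1, 0)" for n
  have "decidable 1 (\<lambda>xs. D (xs ! 0))"
    unfolding D_def by (intro decidable_conj decidable_disj decidable_eq recfun_fst_prod_decode
        recfun_snd_prod_decode recfun_proj recfun_const) auto
  then have re: "re_nat_set {n. D n}" by (rule re_nat_set_if_decidable)
  have 0: "prod_encode (int_encode 0, 0) = 0"
    by (simp add: prod_encode_def int_encode_def sum_encode_def)
  have "(\<lambda>(x, k, a, b). prod_encode (string_code x,
      prod_encode (k, prod_encode (int_encode a, b)))) ` W = {n. D n}"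
  proof (intro equalityI subsetI)
    fix n assume "n \<in> {n. D n}"
    then obtain c where c: "fst (prod_decode n) = string_code [c]"
        "snd (prod_decode (snd (prod_decode n))) = prod_encode (int_encode (of_bool c), 0)"
      by (auto simp: D_def 0)
    let ?k = "fst (prod_decode (snd (prod_decode n)))"
    have "n = prod_encode (string_code [c], prod_encode (?k, prod_encode (int_encode (of_bool c), 0)))"
      by (metis c prod.collapse prod_decode_inverse)
    then show "n \<in> (\<lambda>(x, k, a, b). prod_encode (string_code x,
        prod_encode (k, prod_encode (int_encode a, b)))) ` W"
      by (intro image_eqI[of _ _ "([c], ?k, of_bool c, 0)"]) (auto simp: W_def)
  next
    fix n assume "n \<in> (\<lambda>(x, k, a, b). prod_encode (string_code x,
        prod_encode (k, prod_encode (int_encode a, b)))) ` W"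
    then show "n \<in> {n. D n}"
      by (auto simp: W_def D_def 0 split: if_splits) (metis (full_types) of_bool_eq 0)+
  qed
  with re have "re_nat_set ((\<lambda>(x, k, a, b). prod_encode (string_code x,
      prod_encode (k, prod_encode (int_encode a, b)))) ` W)" by simp
  moreover have "\<forall>(x, k, a, b)\<in>W. \<forall>\<omega>. Fin x \<sqsubseteq>\<^sub>b Infin \<omega> \<longrightarrow>
      \<bar>of_bool (shd \<omega>) - real_of_int a / real (b + 1)\<bar> \<le> 1 / 2 ^ k"
    by (auto simp: W_def)
  moreover have "\<exists>x a b. Fin x \<sqsubseteq>\<^sub>b Infin \<omega> \<and> (x, k, a, b) \<in> W" for \<omega> k
    by (intro exI[of _ "[shd \<omega>]"]) (auto simp: W_def)
  ultimately show ?thesis unfolding computable_real_fun_def by blast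
qed

text \<open>The least \<open>k\<close> with \<open>j < \<sigma> k\<close> is found by a search that
  is total because \<sigma> is unbounded. It is nondecreasing in \<open>j\<close>; adding
  \<open>Suc j\<close> makes the selection strictly increasing and larger than \<open>j\<close>, and
  monotonicity of \<sigma> keeps the bound.\<close>

lemma exists_fast_selection:
  fixes \<sigma> :: "nat \<Rightarrow> nat"
  assumes \<sigma>: "computable_nat_fun \<sigma>" "mono \<sigma>" "\<not> bdd_above (range \<sigma>)"
  obtains m where "computable_nat_fun m" "strict_mono m" "\<And>j. j < m j" "\<And>j. j < \<sigma> (m j)"
proof
  define L where "L j = (LEAST k. j < \<sigma> k)" for j
  have ex: "\<exists>k. j < \<sigma> k" for j
    using \<sigma>(3) by (auto simp: bdd_above_def not_le)
  then have L: "j < \<sigma> (L j)" for j unfolding L_def by (rule LeastI_ex)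
  have \<sigma>': "recfun 1 (\<lambda>xs. \<sigma> (xs ! 0))" using \<sigma>(1) by (simp add: recfun_1_iff del: One_nat_def)
  have "recfun 1 (\<lambda>xs. LEAST k. (k # xs) ! 1 < \<sigma> ((k # xs) ! 0))"
  proof (rule recfun_LEAST[where P = "\<lambda>zs. zs ! 1 < \<sigma> (zs ! 0)"])
    show "decidable (Suc 1) (\<lambda>xs. xs ! 1 < \<sigma> (xs ! 0))"
      by (intro decidable_less recfun_app1[where \<phi> = \<sigma>, OF \<sigma>'] recfun_proj) simp_all
  qed (use ex in simp)
  then have "recfun 1 (\<lambda>xs. L (xs ! 0))" by (simp add: L_def)
  then have "recfun 1 (\<lambda>xs. Suc (xs ! 0 + L (xs ! 0)))"
    by (intro recfun_Suc recfun_add recfun_proj) auto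
  then show "computable_nat_fun (\<lambda>j. Suc (j + L j))" by (simp add: recfun_1_iff del: One_nat_def)
  have "L i \<le> L j" if "i \<le> j" for i j
    unfolding L_def[of i] using L[of j] that by (intro Least_le) simp
  then show "strict_mono (\<lambda>j. Suc (j + L j))"
    by (auto simp: strict_mono_def add_less_le_mono)
  show "j < Suc (j + L j)" for j by simp
  show "j < \<sigma> (Suc (j + L j))" for j
    using L[of j] monoD[OF \<sigma>(2), of "L j" "Suc (j + L j)"] by simp
qed

section \<open>Measure preservation and ergodicity\<close>

lemma (in prob_space) measurable_subseq_stream [measurable]:
  "subseq_stream m \<in> stream_space M \<rightarrow>\<^sub>M stream_space M"
  by (rule measurable_stream_space2) simp

text \<open>The stream measure is the image of the product measure under \<open>to_stream\<close>,
  which taking coordinates inverts. This carries facts on product measures over to streams.\<close>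

lemma (in prob_space) distr_stream_space_snth_family:
  "distr (stream_space M) (\<Pi>\<^sub>M i\<in>UNIV. M) (\<lambda>\<omega> i. \<omega> !! i) = (\<Pi>\<^sub>M i\<in>UNIV. M)"
proof -
  have "distr (stream_space M) (\<Pi>\<^sub>M i\<in>UNIV. M) (\<lambda>\<omega> i. \<omega> !! i) =
      distr (\<Pi>\<^sub>M i\<in>UNIV. M) (\<Pi>\<^sub>M i\<in>UNIV. M) ((\<lambda>\<omega> i. \<omega> !! i) \<circ> to_stream)"
    by (subst stream_space_eq_distr) (intro distr_distr measurable_snth_PiM measurable_to_stream)
  also have "(\<lambda>\<omega> i. \<omega> !! i) \<circ> to_stream = (\<lambda>X. X :: nat \<Rightarrow> 'a)"
    by (auto simp: fun_eq_iff to_stream_def)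
  finally show ?thesis by simp
qed

lemma (in prob_space) distr_stream_space_snth: "distr (stream_space M) M (\<lambda>\<omega>. \<omega> !! i) = M"
proof -
  interpret P: product_prob_space "\<lambda>_. M" UNIV
    by standard
  have "distr (stream_space M) M (\<lambda>\<omega>. \<omega> !! i) =
      distr (distr (stream_space M) (\<Pi>\<^sub>M i\<in>UNIV. M) (\<lambda>\<omega> i. \<omega> !! i)) M (\<lambda>X. X i)"
    by (subst distr_distr) (auto intro: measurable_snth_PiM simp: comp_def)
  then show ?thesis
    using P.PiM_component[of i] by (simp add: distr_stream_space_snth_family)
qed

text \<open>On the product space, selection is a reindexing of coordinates, and an injective
  reindexing of identically distributed independent coordinates leaves the product measure
  unchanged.\<close>

lemma (in prob_space) distr_subseq_stream:
  assumes "inj m"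
  shows "distr (stream_space M) (stream_space M) (subseq_stream m) = stream_space M"
proof -
  let ?P = "\<Pi>\<^sub>M i\<in>UNIV :: nat set. M"
  have [measurable]: "(\<lambda>X i. X (m i)) \<in> ?P \<rightarrow>\<^sub>M ?P"
    by (rule measurable_PiM_single') (auto simp: space_PiM)
  have "distr (stream_space M) (stream_space M) (subseq_stream m) =
      distr ?P (stream_space M) (subseq_stream m \<circ> to_stream)"
    by (subst stream_space_eq_distr) (intro distr_distr measurable_subseq_stream measurable_to_stream)
  also have "subseq_stream m \<circ> to_stream = to_stream \<circ> (\<lambda>X i. X (m i) :: 'a)"
    by (auto simp: fun_eq_iff subseq_stream_def to_stream_def)
  also have "distr ?P (stream_space M) \<dots> = distr (distr ?P ?P (\<lambda>X i. X (m i))) (stream_space M) to_stream"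
    by (simp add: distr_distr)
  also have "distr ?P ?P (\<lambda>X i. X (m i)) = ?P"
    using distr_PiM_reindex[of UNIV "\<lambda>_. M" m UNIV] assms prob_space_axioms
    by (simp add: restrict_UNIV)
  finally show ?thesis by (simp only: stream_space_eq_distr[symmetric])
qed

lemma (in prob_space) measure_preserving_subseq_stream:
  assumes "inj m"
  shows "measure_preserving (stream_space M) (subseq_stream m)"
  unfolding measure_preserving_def
proof (intro conjI ballI measurable_subseq_stream)
  fix A assume A: "A \<in> sets (stream_space M)"
  have "emeasure (stream_space M) A =
      emeasure (distr (stream_space M) (stream_space M) (subseq_stream m)) A"
    by (simp add: distr_subseq_stream[OF assms])
  also have "\<dots> = emeasure (stream_space M) (subseq_stream m -` A \<inter> space (stream_space M))"
    by (rule emeasure_distr[OF measurable_subseq_stream A])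
  finally show "emeasure (stream_space M) (subseq_stream m -` A \<inter> space (stream_space M)) =
      emeasure (stream_space M) A" ..
qed

text \<open>Independence amounts to the joint distribution being the product of the
  marginals.\<close>

lemma (in prob_space) indep_vars_snth:
  "prob_space.indep_vars (stream_space M) (\<lambda>_. M) (\<lambda>i \<omega>. \<omega> !! i) UNIV"
proof -
  interpret S: prob_space "stream_space M" by (rule prob_space_stream_space)
  show ?thesis
    by (subst S.indep_vars_iff_distr_eq_PiM)
      (auto simp: distr_stream_space_snth restrict_UNIV distr_stream_space_snth_family)
qed

lemma subseq_stream_funpow: "subseq_stream m ^^ n = subseq_stream (m ^^ n)"
proof (induction n)
  case 0
  show ?case by (auto intro: stream_eqI simp: fun_eq_iff)
next
  case (Suc n)
  then show ?case by (auto intro!: stream_eqI simp: fun_eq_iff funpow_swap1)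
qed

lemma funpow_ge:
  fixes m :: "nat \<Rightarrow> nat"
  assumes "\<And>j. j < m j"
  shows "n + j \<le> (m ^^ n) j"
proof (induction n)
  case (Suc n)
  with assms[of "(m ^^ n) j"] show ?case by simp
qed simp

text \<open>An invariant set only depends on the coordinates in the range of every iterate of
  \<open>m\<close>, hence is a tail event.\<close>

lemma (in prob_space) ergodic_subseq_stream:
  assumes m: "\<And>j. j < m j"
  shows "ergodic (stream_space M) (subseq_stream m)"
  unfolding ergodic_def
proof (intro ballI impI)
  let ?S = "stream_space M" and ?T = "subseq_stream m"
  interpret S: prob_space ?S by (rule prob_space_stream_space)
  fix A assume A: "A \<in> sets ?S" and inv: "?T -` A \<inter> space ?S = A"
  \<comment> \<open>The events that depend on coordinate \<open>i\<close> alone; the zero-one law is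
    applied to this independent sequence.\<close>
  define F where "F i = sigma_sets (space ?S) {(\<lambda>\<omega>. \<omega> !! i) -` B \<inter> space ?S |B. B \<in> sets M}" for i
  have F_space: "F i \<subseteq> Pow (space ?S)" for i
    using sigma_sets_into_sp[of "{(\<lambda>\<omega>. \<omega> !! i) -` B \<inter> space ?S |B. B \<in> sets M}" "space ?S"]
    by (auto simp: F_def)
  have indep: "S.indep_sets F UNIV"
    using indep_vars_snth unfolding S.indep_vars_def F_def by blast
  have inv_n: "(?T ^^ n) -` A \<inter> space ?S = A" for n
  proof (induction n)
    case 0
    show ?case using sets.sets_into_space[OF A] by auto
  next
    case (Suc n)
    have "(?T ^^ Suc n) -` A \<inter> space ?S = ?T -` ((?T ^^ n) -` A \<inter> space ?S) \<inter> space ?S"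
      using measurable_space[OF measurable_subseq_stream] by (auto simp: funpow_swap1)
    with Suc inv show ?case by (simp only:)
  qed
  have "A \<in> sigma_sets (space ?S) (\<Union> (F ` {n..}))" for n
  proof -
    \<comment> \<open>The events depending on coordinates from \<open>n\<close> on. The
      \<open>n\<close>-th iterate is measurable already from this smaller \<sigma>-algebra, since it
      reads only positions \<open>(m ^^ n) j \<ge> n\<close>, and \<open>A\<close> is its own
      preimage under that iterate.\<close>
    let ?N = "sigma (space ?S) (\<Union> (F ` {n..}))"
    have "?T ^^ n \<in> ?N \<rightarrow>\<^sub>M ?S"
      unfolding subseq_stream_funpow
    proof (rule measurable_stream_space2)
      fix j
      have "(m ^^ n) j \<ge> n" using funpow_ge[of m n j] m by simp
      then have "(\<lambda>\<omega>. \<omega> !! (m ^^ n) j) -` B \<inter> space ?S \<in> sets ?N" if "B \<in> sets M" for B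
        using that F_space
        by (subst sets_measure_of) (auto simp: F_def intro!: sigma_sets.Basic bexI[of _ "(m ^^ n) j"])
      then show "(\<lambda>\<omega>. subseq_stream (m ^^ n) \<omega> !! j) \<in> ?N \<rightarrow>\<^sub>M M"
        using F_space
        by (intro measurableI) (auto simp: space_measure_of_conv dest: measurable_space[OF measurable_snth])
    qed
    from measurable_sets[OF this A] show ?thesis
      using F_space inv_n[of n] by (subst (asm) sets_measure_of) (auto simp: space_measure_of_conv)
  qed
  then have "A \<in> S.tail_events F" by (simp add: S.tail_events_def)
  moreover have "sigma_algebra (space ?S) (F i)" for i
    unfolding F_def by (rule sigma_algebra_sigma_sets) auto
  ultimately have "S.prob A = 0 \<or> S.prob A = 1" by (intro S.kolmogorov_0_1_law[OF _ indep])
  then show "emeasure ?S A = 0 \<or> emeasure ?S A = 1"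
    by (auto simp: S.emeasure_eq_measure)
qed

interpretation bernoulli_half: prob_space bernoulli_half
  unfolding bernoulli_half_def by (rule prob_space.prob_space_stream_space[OF prob_space_measure_pmf])

text \<open>Cylinders over arbitrary finite sets of positions are needed because the positions left
  free by the prescription need not form an initial segment. Independence multiplies the factors
  1/2.\<close>

lemma emeasure_bernoulli_half_coordinates:
  assumes "finite J"
  shows "emeasure bernoulli_half {\<alpha>. \<forall>j\<in>J. \<alpha> !! j = x j} = ennreal ((1 / 2) ^ card J)"
proof (cases "J = {}")
  case True
  then show ?thesis
    using bernoulli_half.emeasure_space_1 by (simp add: space_bernoulli_half)
next
  case False
  let ?X = "\<lambda>j. (\<lambda>\<alpha> :: bool stream. \<alpha> !! j) -` {x j} \<inter> space bernoulli_half"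
  have half: "bernoulli_half.prob (?X j) = 1 / 2" for j
  proof -
    have "bernoulli_half.prob (?X j) =
        measure (distr bernoulli_half (measure_pmf (bernoulli_pmf (1 / 2))) (\<lambda>\<alpha>. \<alpha> !! j)) {x j}"
      by (subst measure_distr) (auto simp: bernoulli_half_def)
    also have "\<dots> = measure (measure_pmf (bernoulli_pmf (1 / 2))) {x j}"
      using measure_pmf.distr_stream_space_snth[of "bernoulli_pmf (1 / 2)" j] by (simp add: bernoulli_half_def)
    also have "\<dots> = 1 / 2" by (cases "x j") (auto simp: measure_pmf_single)
    finally show ?thesis .
  qed
  have "bernoulli_half.prob (\<Inter>j\<in>J. ?X j) = (\<Prod>j\<in>J. bernoulli_half.prob (?X j))"
    by (rule bernoulli_half.indep_varsD[of "\<lambda>_. measure_pmf (bernoulli_pmf (1 / 2))" _ UNIV])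
      (use False assms measure_pmf.indep_vars_snth in \<open>auto simp: bernoulli_half_def\<close>)
  also have "(\<Inter>j\<in>J. ?X j) = {\<alpha>. \<forall>j\<in>J. \<alpha> !! j = x j}"
    using False by (auto simp: space_bernoulli_half)
  finally show ?thesis
    by (simp add: bernoulli_half.emeasure_eq_measure half)
qed

section \<open>Incompressible sequences with prescribed bits\<close>

lemma bseq_le_trans: "u \<sqsubseteq>\<^sub>b v \<Longrightarrow> v \<sqsubseteq>\<^sub>b w \<Longrightarrow> u \<sqsubseteq>\<^sub>b w"
proof (cases u; cases v; cases w)
  fix x y \<omega>
  assume "u \<sqsubseteq>\<^sub>b v" "v \<sqsubseteq>\<^sub>b w" "u = Fin x" "v = Fin y" "w = Infin \<omega>"
  then show ?thesis
    by (auto simp: stake_eq_iff prefix_def nth_append)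
qed auto

text \<open>A longer input yields more outputs, so every upper bound of the outputs on
  \<open>v\<close> bounds those on \<open>u\<close>.\<close>

lemma apply_operation_mono:
  assumes "computable_operation P" "u \<sqsubseteq>\<^sub>b v"
  shows "apply_operation P u \<sqsubseteq>\<^sub>b apply_operation P v"
proof -
  have "operation_outputs P u \<subseteq> operation_outputs P v"
    using bseq_le_trans[OF _ assms(2)] by (auto simp: operation_outputs_def)
  then show ?thesis
    using operation_is_sup[OF assms(1)] unfolding is_bseq_sup_def by (meson subsetD)
qed

definition override_stream :: "nat set \<Rightarrow> (nat \<Rightarrow> 'a) \<Rightarrow> 'a stream \<Rightarrow> 'a stream" where
  "override_stream P b \<alpha> = to_stream (\<lambda>n. if n \<in> P then b n else \<alpha> !! n)"

lemma snth_override_stream [simp]: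
  "override_stream P b \<alpha> !! n = (if n \<in> P then b n else \<alpha> !! n)"
  by (simp add: override_stream_def to_stream_def)

lemma measurable_override_stream:
  "override_stream P b \<in> bernoulli_half \<rightarrow>\<^sub>M bernoulli_half"
  unfolding bernoulli_half_def by (rule measurable_stream_space2) simp

text \<open>Kraft's inequality for the shortest programs of the minimal compressible strings \<open>x\<close>:
  prescribing at most \<open>\<sigma> (length x)\<close> bits multiplies the measure of the cylinder of \<open>x\<close> by at
  most \<open>2 ^ \<sigma> (length x)\<close>, so compressibility by more than that leaves total mass
  at most one half.\<close>

lemma exists_incompressible_with_prescribed_bits:
  assumes \<psi>: "computable_operation \<psi>" and sparse: "\<And>n. card (P \<inter> {..<n}) \<le> \<sigma> n"
  shows "\<exists>\<omega>. (\<forall>n\<in>P. \<omega> !! n = b n) \<and> (\<forall>n. enat n \<le> Km \<psi> (stake n \<omega>) + enat (\<sigma> n))"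
proof -
  \<comment> \<open>Stated by addition in \<open>enat\<close>, so that a string of infinite
    complexity is never bad.\<close>
  define bad where "bad x \<longleftrightarrow> Km \<psi> x + enat (\<sigma> (length x)) < enat (length x)" for x
  \<comment> \<open>Keeping only bad strings without a bad proper prefix makes them pairwise
    incomparable.\<close>
  define X where "X = {x. bad x \<and> (\<forall>k<length x. \<not> bad (take k x))}"
  have "\<exists>p. Fin x \<sqsubseteq>\<^sub>b apply_operation \<psi> (Fin p) \<and> length p + \<sigma> (length x) < length x"
    if "bad x" for x
  proof -
    have "Km \<psi> x < enat (length x - \<sigma> (length x))"
      using that by (cases "Km \<psi> x") (auto simp: bad_def)
    then obtain p where "Fin x \<sqsubseteq>\<^sub>b apply_operation \<psi> (Fin p)"
      "enat (length p) < enat (length x - \<sigma> (length x))"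
      unfolding Km_def INF_less_iff by blast
    then show ?thesis by auto
  qed
  then obtain p where p: "\<And>x. bad x \<Longrightarrow> Fin x \<sqsubseteq>\<^sub>b apply_operation \<psi> (Fin (p x))"
      "\<And>x. bad x \<Longrightarrow> length (p x) + \<sigma> (length x) < length x"
    by metis
  have antichain: "x = x'" if "x \<in> X" "x' \<in> X" "prefix x x' \<or> prefix x' x" for x x'
  proof -
    have *: "u = v" if uv: "u \<in> X" "v \<in> X" "prefix u v" for u v
    proof (rule ccontr)
      assume "u \<noteq> v"
      with uv(3) have "length u < length v" "take (length u) v = u"
        by (auto simp: prefix_def)
      with uv(1,2) show False unfolding X_def by auto
    qed
    from that show ?thesis using *[of x x'] *[of x' x] by blast
  qed
  let ?C = "\<lambda>x. {\<alpha>. stake (length (p x)) \<alpha> = p x}"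
  \<comment> \<open>The fair sequence is \<alpha>; \<open>?E x\<close> is the event that it starts
    with \<open>x\<close> after the bits on \<open>P\<close> have been overwritten.\<close>
  let ?E = "\<lambda>x. {\<alpha>. stake (length x) (override_stream P b \<alpha>) = x}"
  have "disjoint_family_on ?C X"
  unfolding disjoint_family_on_def
  proof (intro ballI impI, rule ccontr)
    fix x x' assume x: "x \<in> X" "x' \<in> X" "x \<noteq> x'" and "?C x \<inter> ?C x' \<noteq> {}"
    then obtain \<alpha> where "Fin (p x) \<sqsubseteq>\<^sub>b Infin \<alpha>" "Fin (p x') \<sqsubseteq>\<^sub>b Infin \<alpha>" by auto
    then have "Fin (p x) \<sqsubseteq>\<^sub>b Fin (p x') \<or> Fin (p x') \<sqsubseteq>\<^sub>b Fin (p x)"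
      using Fin_le_Fin_linear unfolding bseq_le.simps(1) by blast
    \<comment> \<open>The witness is the output on the longer of the two programs, which by
      monotonicity extends both strings.\<close>
    then obtain w where "Fin x \<sqsubseteq>\<^sub>b w" "Fin x' \<sqsubseteq>\<^sub>b w"
      using p(1)[of x] p(1)[of x'] x(1,2) unfolding X_def
      by (metis (no_types, lifting) mem_Collect_eq apply_operation_mono[OF \<psi>] bseq_le_trans)
    then have "prefix x x' \<or> prefix x' x" by (rule Fin_le_Fin_linear)
    with antichain x show False by blast
  qed
  moreover have "disjoint_family_on ?E X"
  unfolding disjoint_family_on_def
  proof (intro ballI impI, rule ccontr)
    fix x x' assume x: "x \<in> X" "x' \<in> X" "x \<noteq> x'" and "?E x \<inter> ?E x' \<noteq> {}"
    then obtain \<alpha> where "Fin x \<sqsubseteq>\<^sub>b Infin (override_stream P b \<alpha>)"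
        "Fin x' \<sqsubseteq>\<^sub>b Infin (override_stream P b \<alpha>)" by auto
    then have "prefix x x' \<or> prefix x' x" by (rule Fin_le_Fin_linear)
    with antichain x show False by blast
  qed
  moreover have E_sets: "?E x \<in> sets bernoulli_half" for x
    using measurable_sets[OF measurable_override_stream sets_cylinder[of x]]
    by (simp add: space_bernoulli_half vimage_def)
  ultimately have
      E: "emeasure bernoulli_half (\<Union>x\<in>X. ?E x) =
        (\<integral>\<^sup>+x. emeasure bernoulli_half (?E x) \<partial>count_space X)"
    and C: "emeasure bernoulli_half (\<Union>x\<in>X. ?C x) =
        (\<integral>\<^sup>+x. emeasure bernoulli_half (?C x) \<partial>count_space X)"
    by (auto intro!: emeasure_UN_countable sets_cylinder)
  \<comment> \<open>Beyond the prescribed positions at least \<open>length (p x) + 1\<close>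
    positions of \<open>x\<close> stay free. The strict inequality in \<open>bad\<close> gives the
    extra one, hence the factor 1/2 that keeps the total below 1.\<close>
  have "emeasure bernoulli_half (?E x) \<le> ennreal (1 / 2) * emeasure bernoulli_half (?C x)"
    if "x \<in> X" for x
  proof -
    let ?J = "{..<length x} - P"
    have "length x = card ?J + card (P \<inter> {..<length x})"
      using card_Int_Diff[of "{..<length x}" P] by (simp add: Int_commute)
    then have "Suc (length (p x)) \<le> card ?J"
      using p(2)[of x] sparse[of "length x"] that by (simp add: X_def)
    have "?E x \<subseteq> {\<alpha>. \<forall>j\<in>?J. \<alpha> !! j = x ! j}"
      by (auto simp: stake_eq_iff)
    moreover have "{\<alpha>. \<forall>j\<in>?J. \<alpha> !! j = x ! j} \<in> sets bernoulli_half"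
    proof -
      have "{\<alpha> \<in> space bernoulli_half. \<forall>j\<in>?J. \<alpha> !! j = x ! j} \<in> sets bernoulli_half"
        unfolding bernoulli_half_def by measurable
      then show ?thesis by (simp add: space_bernoulli_half)
    qed
    ultimately have "emeasure bernoulli_half (?E x) \<le> ennreal ((1 / 2) ^ card ?J)"
      using emeasure_mono emeasure_bernoulli_half_coordinates[of ?J "(!) x"] by fastforce
    also have "\<dots> \<le> ennreal ((1 / 2) ^ Suc (length (p x)))"
      using \<open>Suc (length (p x)) \<le> card ?J\<close> by (intro ennreal_leI power_decreasing) auto
    also have "\<dots> = ennreal (1 / 2) * emeasure bernoulli_half (?C x)"
      unfolding emeasure_cylinder power_Suc by (rule ennreal_mult) auto
    finally show ?thesis .
  qed
  then have "emeasure bernoulli_half (\<Union>x\<in>X. ?E x) \<le>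
      (\<integral>\<^sup>+x. ennreal (1 / 2) * emeasure bernoulli_half (?C x) \<partial>count_space X)"
    unfolding E by (intro nn_integral_mono) auto
  also have "\<dots> = ennreal (1 / 2) * emeasure bernoulli_half (\<Union>x\<in>X. ?C x)"
    unfolding C by (rule nn_integral_cmult) simp
  also have "\<dots> \<le> ennreal (1 / 2) * 1"
    by (intro mult_left_mono bernoulli_half.emeasure_le_1) auto
  also have "\<dots> < 1"
    using ennreal_lessI[of 1 "1 / 2"] by (simp only: mult_1_right ennreal_1)
  finally have "(\<Union>x\<in>X. ?E x) \<noteq> UNIV"
    using bernoulli_half.emeasure_space_1 by (auto simp: space_bernoulli_half)
  then obtain \<alpha> where \<alpha>: "\<And>x. x \<in> X \<Longrightarrow> \<alpha> \<notin> ?E x" by blast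
  let ?\<omega> = "override_stream P b \<alpha>"
  \<comment> \<open>A shortest bad prefix would belong to \<open>X\<close>, which the choice of
    \<alpha> excludes.\<close>
  have "\<not> bad (stake n ?\<omega>)" for n
  proof (induction n rule: less_induct)
    case (less n)
    then have "\<not> bad (take k (stake n ?\<omega>))" if "k < n" for k
      using that by (simp add: take_stake min_def)
    moreover have "stake n ?\<omega> \<notin> X" using \<alpha>[of "stake n ?\<omega>"] by auto
    ultimately show ?case by (auto simp: X_def)
  qed
  then show ?thesis
    by (intro exI[of _ ?\<omega>]) (auto simp: bad_def not_less)
qed

section \<open>A bit pattern without a density, and the sparsity of the orbit of 0 under the
  selection function\<close>

text \<open>The pattern is constant on the dyadic blocks from \<open>2 ^ k\<close> to
  \<open>2 ^ Suc k\<close>, with the value alternating in \<open>k\<close>; each block is as long as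
  everything before it, so it shifts the average noticeably. The bit at index 0 is left
  free.\<close>

lemma exists_cesaro_divergent_bits:
  obtains c :: "nat \<Rightarrow> bool" where
    "\<And>a :: nat \<Rightarrow> bool. (\<And>i. i \<ge> 1 \<Longrightarrow> a i = c i) \<Longrightarrow>
      \<not> convergent (\<lambda>n. (1 / real n) * (\<Sum>i<n. of_bool (a i)))"
proof
  fix a :: "nat \<Rightarrow> bool"
  \<comment> \<open>The right-hand side is the witness for \<open>c\<close>.\<close>
  assume a: "\<And>i. i \<ge> 1 \<Longrightarrow> a i = (\<exists>k. even k \<and> 2 ^ k \<le> i \<and> i < 2 ^ Suc k)"
  have a': "a i = even k" if "2 ^ k \<le> i" "i < 2 ^ Suc k" for i k
  proof -
    have "l = k" if "2 ^ l \<le> i" "i < 2 ^ Suc l" for l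
    proof -
      have "(2::nat) ^ l < 2 ^ Suc k" "(2::nat) ^ k < 2 ^ Suc l"
        using that \<open>2 ^ k \<le> i\<close> \<open>i < 2 ^ Suc k\<close> by linarith+
      then have "l < Suc k" "k < Suc l"
        by (metis one_less_numeral_iff power_strict_increasing_iff semiring_norm(76))+
      then show ?thesis by simp
    qed
    moreover have "a i = (\<exists>k. even k \<and> 2 ^ k \<le> i \<and> i < 2 ^ Suc k)"
      using that(1) one_le_power[of "2::nat" k] by (intro a) linarith
    ultimately show ?thesis using that by blast
  qed
  let ?A = "\<lambda>n. (1 / real n) * (\<Sum>i<n. of_bool (a i))"
  define D where "D k = ?A (2 ^ k)" for k
  \<comment> \<open>The average up to \<open>2 ^ Suc k\<close> is the mean of the average up to
    \<open>2 ^ k\<close> and the constant value on the next block.\<close>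
  have step: "D (Suc k) = D k / 2 + of_bool (even k) / 2" for k
  proof -
    have "{..<(2::nat) ^ Suc k} = {..<2 ^ k} \<union> {2 ^ k..<2 ^ Suc k}"
      by (rule ivl_disj_un(8)[symmetric]) simp
    then have "(\<Sum>i<2 ^ Suc k. of_bool (a i)) =
        (\<Sum>i\<in>{..<2 ^ k} \<union> {2 ^ k..<2 ^ Suc k}. of_bool (a i) :: real)"
      by (rule arg_cong)
    also have "\<dots> = (\<Sum>i<2 ^ k. of_bool (a i)) + (\<Sum>i\<in>{2 ^ k..<2 ^ Suc k}. of_bool (a i))"
      by (rule sum.union_disjoint) auto
    also have "(\<Sum>i\<in>{2 ^ k..<2 ^ Suc k}. of_bool (a i) :: real) =
        (\<Sum>i\<in>{(2::nat) ^ k..<2 ^ Suc k}. of_bool (even k))"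
      using a' by (intro sum.cong) (auto simp del: power_Suc)
    also have "\<dots> = 2 ^ k * of_bool (even k)" by simp
    finally show ?thesis unfolding D_def by (simp add: field_simps)
  qed
  show "\<not> convergent ?A"
  proof
    assume "convergent ?A"
    then obtain L where L: "?A \<longlonglongrightarrow> L" by (auto simp: convergent_def)
    have D: "D \<longlonglongrightarrow> L"
      using LIMSEQ_subseq_LIMSEQ[OF L, of "\<lambda>k. 2 ^ k"]
      by (simp add: comp_def D_def[abs_def] strict_mono_def)
    have lim: "(\<lambda>k. D (g k)) \<longlonglongrightarrow> L" if "strict_mono g" for g
      using LIMSEQ_subseq_LIMSEQ[OF D that] by (simp add: comp_def)
    \<comment> \<open>A limit \<open>L\<close> would have to be fixed by both forms of the
      recursion, at even and at odd \<open>k\<close>, which forces \<open>L = 1\<close> and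
      \<open>L = 0\<close>.\<close>
    have "(\<lambda>k. D (Suc (2 * k))) \<longlonglongrightarrow> L" "(\<lambda>k. D (Suc (Suc (2 * k)))) \<longlonglongrightarrow> L"
      and even: "(\<lambda>k. D (2 * k)) \<longlonglongrightarrow> L"
      by (intro lim; simp add: strict_mono_def)+
    then have "(\<lambda>k. D (2 * k) / 2 + 1 / 2) \<longlonglongrightarrow> L" "(\<lambda>k. D (Suc (2 * k)) / 2) \<longlonglongrightarrow> L"
      by (simp_all add: step)
    moreover have "(\<lambda>k. D (2 * k) / 2 + 1 / 2) \<longlonglongrightarrow> L / 2 + 1 / 2"
      by (intro tendsto_intros even) simp_all
    moreover have "(\<lambda>k. D (Suc (2 * k)) / 2) \<longlonglongrightarrow> L / 2"
      by (intro tendsto_intros lim) (simp_all add: strict_mono_def)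
    ultimately have "L = L / 2 + 1 / 2" "L = L / 2" by (blast dest: LIMSEQ_unique)+
    then show False by simp
  qed
qed

text \<open>If the \<open>Suc i\<close>-th iterate is below \<open>n\<close>, then
  \<open>i \<le> (m ^^ i) 0\<close>, and the growth condition at \<open>(m ^^ i) 0\<close> gives
  \<open>i < \<sigma> n\<close>. The iterates start at \<open>m 0\<close> because position 0 lies
  below 1 although \<open>\<sigma> 1\<close> may be 0.\<close>

lemma card_iterates_le:
  fixes m \<sigma> :: "nat \<Rightarrow> nat"
  assumes m: "\<And>j. j < m j" and \<sigma>: "mono \<sigma>" "\<And>j. j < \<sigma> (m j)"
  shows "card ((\<lambda>i. (m ^^ Suc i) 0) ` UNIV \<inter> {..<n}) \<le> \<sigma> n"
proof -
  let ?q = "\<lambda>i. (m ^^ Suc i) 0"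
  have q: "i \<le> ?q i" for i using funpow_ge[of m "Suc i" 0] m by simp
  have "i < \<sigma> n" if "?q i < n" for i
  proof -
    have "i \<le> (m ^^ i) 0" using funpow_ge[of m i 0] m by simp
    also have "\<dots> < \<sigma> (?q i)" using \<sigma>(2) by simp
    also have "\<dots> \<le> \<sigma> n" using that by (intro monoD[OF \<sigma>(1)]) simp
    finally show ?thesis .
  qed
  then have "?q ` UNIV \<inter> {..<n} \<subseteq> ?q ` {..<\<sigma> n}" by auto
  then have "card (?q ` UNIV \<inter> {..<n}) \<le> card (?q ` {..<\<sigma> n})" by (intro card_mono) auto
  also have "\<dots> \<le> \<sigma> n" using card_image_le[of "{..<\<sigma> n}" ?q] by simp
  finally show ?thesis .
qed

theorem theorem2:
  fixes \<psi> :: "(bool list \<times> bool list) set" and \<sigma> :: "nat \<Rightarrow> nat"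
  assumes "optimal_operation \<psi>"
    and "computable_nat_fun \<sigma>" and "mono \<sigma>" and "\<not> bdd_above (range \<sigma>)"
  shows "\<exists>(T :: bool stream \<Rightarrow> bool stream) (\<omega> :: bool stream).
           computable_transformation T \<and>
           measure_preserving bernoulli_half T \<and>
           ergodic bernoulli_half T \<and>
           (\<forall>n. enat n \<le> Km \<psi> (stake n \<omega>) + enat (\<sigma> n)) \<and>
           (\<exists>f :: bool stream \<Rightarrow> real.
              computable_real_fun f \<and> (\<forall>\<alpha>. f \<alpha> \<in> {0, 1}) \<and>
              \<not> convergent (\<lambda>n. (1 / real n) * (\<Sum>i<n. f ((T ^^ i) \<omega>))))"
proof -
  obtain m where m: "computable_nat_fun m" "strict_mono m" "\<And>j. j < m j" "\<And>j. j < \<sigma> (m j)"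
    using exists_fast_selection[OF assms(2-4)] by blast
  obtain c :: "nat \<Rightarrow> bool" where c: "\<And>a :: nat \<Rightarrow> bool. (\<And>i. i \<ge> 1 \<Longrightarrow> a i = c i) \<Longrightarrow>
      \<not> convergent (\<lambda>n. (1 / real n) * (\<Sum>i<n. of_bool (a i)))"
    using exists_cesaro_divergent_bits by blast
  let ?q = "\<lambda>i. (m ^^ Suc i) 0"
  have "strict_mono ?q" using m(3) by (auto simp: strict_mono_Suc_iff)
  then have "inj ?q" by (rule strict_mono_imp_inj_on)
  have \<psi>: "computable_operation \<psi>" using assms(1) by (simp add: optimal_operation_def)
  \<comment> \<open>By injectivity \<open>inv ?q\<close> recovers the index of a prescribed
    position; the successor appears because \<open>?q k\<close> is the \<open>Suc k\<close>-th
    iterate.\<close>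
  obtain \<omega> where \<omega>: "\<And>n. n \<in> range ?q \<Longrightarrow> \<omega> !! n = c (Suc (inv ?q n))"
      "\<And>n. enat n \<le> Km \<psi> (stake n \<omega>) + enat (\<sigma> n)"
    using exists_incompressible_with_prescribed_bits[OF \<psi>,
        of "range ?q" \<sigma> "\<lambda>n. c (Suc (inv ?q n))"]
      card_iterates_le[OF m(3) assms(3) m(4)] by blast
  \<comment> \<open>Index 0 is excluded since position 0 is not prescribed; the choice of
    \<open>c\<close> tolerates an arbitrary bit there.\<close>
  have bits: "\<omega> !! (m ^^ i) 0 = c i" if i: "i \<ge> 1" for i
  proof -
    obtain k where "i = Suc k" using i by (cases i) auto
    then show ?thesis
      using \<omega>(1)[of "?q k"] inv_f_f[OF \<open>inj ?q\<close>, of k] by simp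
  qed
  have orbit: "of_bool (shd ((subseq_stream m ^^ i) \<omega>)) = (of_bool (\<omega> !! (m ^^ i) 0) :: real)" for i
    using snth_subseq_stream[of "m ^^ i" \<omega> 0] by (simp add: subseq_stream_funpow)
  show ?thesis
  proof (intro exI conjI allI)
    show "computable_transformation (subseq_stream m)"
      by (rule computable_subseq_stream[OF m(1)])
    show "measure_preserving bernoulli_half (subseq_stream m)"
      unfolding bernoulli_half_def
      by (rule measure_pmf.measure_preserving_subseq_stream[OF strict_mono_imp_inj_on[OF m(2)]])
    show "ergodic bernoulli_half (subseq_stream m)"
      unfolding bernoulli_half_def by (rule measure_pmf.ergodic_subseq_stream[OF m(3)])
    show "enat n \<le> Km \<psi> (stake n \<omega>) + enat (\<sigma> n)" for n by (rule \<omega>(2))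
    show "computable_real_fun (\<lambda>\<omega>. of_bool (shd \<omega>))" by (rule computable_real_fun_shd)
    show "of_bool (shd \<alpha>) \<in> {0, 1 :: real}" for \<alpha> by simp
    show "\<not> convergent (\<lambda>n. (1 / real n) * (\<Sum>i<n. of_bool (shd ((subseq_stream m ^^ i) \<omega>))))"
      unfolding orbit by (rule c) (rule bits)
  qed
qed

end
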